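(* Let $C_1,\dots,C_m$ be closed subsets of a Euclidean space $X$, $I=\{1,\dots,m\}$, and $w\in C:=\bigcap_{i\in I}C_i$. Let $\ell$ be a positive integer and $J:=\{1,\dots,\ell\}$. For every $j\in J$, let $\lambda_j,\mu_j\in(0,2]$, $\alpha_j\in(0,1)$, and $s_j,t_j\in I$ with $s_j\ne t_j$, such that $\{s_j: j\in J\}\cup\{t_j: j\in J\}=I$, and let $$T_j:=(1-\alpha_j)\mathrm{Id}+\alpha_jP_{C_{t_j}}^{\mu_j}P_{C_{s_j}}^{\lambda_j}.$$ Suppose that the system $\{C_i\}_{i\in I}$ is superregular at $w$ and linearly regular around $w$, and that $\{C_{s_j},C_{t_j}\}$ is strongly regular at $w$ for every $j\in J$. Then, when started at a point sufficiently close to $w$ (i.e., there is $r>0$ such that this holds for all $x_0\in\mathbb{B}(w;r)$), every cyclic generalized Douglas--Rachford sequence generated by $(T_j)_{j\in J}$ converges $R$-linearly to a point $\bar x\in C$.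
   Context: $X$ is a Euclidean space with inner product $\langle\cdot,\cdot\rangle$ and norm $\|\cdot\|$. $\mathbb{B}(w;\rho)$ is the closed ball with center $w$ and radius $\rho$. For a nonempty closed set $C$: $d_C(x)=\inf_{c\in C}\|x-c\|$, $P_Cx=\{c\in C:\|x-c\|=d_C(x)\}$ (set-valued projector), and $P_C^\lambda:=(1-\lambda)\mathrm{Id}+\lambda P_C$ is the (set-valued) relaxed projector. Compositions of set-valued operators are $(ST)x=\bigcup_{y\in Tx}Sy$. A cyclic sequence generated by $(T_j)_{j\in J}$ is any sequence with $x_0\in X$ and $x_{n+1}\in T_{n+1}x_n$ for all $n\in\mathbb{N}=\{0,1,\dots\}$, where $T_{\ell n+j}:=T_j$ for $n\in\mathbb{N}$, $j\in J$. $(x_n)$ converges $R$-linearly to $\bar x$ if there are $\rho\in[0,1)$ and $\sigma\ge0$ with $\|x_n-\bar x\|\le\sigma\rho^n$ for all $n\in\mathbb{N}$. Linear regularity: $\{C_i\}_{i\in I}$ is linearly regular around $w$ if there are $\delta>0$, $\kappa>0$ with $d_C(x)\le\kappa\max_{i\in I}d_{C_i}(x)$ for all $x\in\mathbb{B}(w;\delta)$, where $C=\bigcap_{i\in I}C_i$. Normal cones: the proximal normal cone to $C$ at $x\in C$ is $N^{\rm prox}_C(x)=\{\lambda(z-x): x\in P_Cz,\ \lambda\ge0\}$. The limiting normal cone $N_C(x)$ is the set of $u\in X$ for which there exist $x_n\to x$ and $u_n\to u$ with $x_n\in C$ and $u_n\in N^{\rm prox}_C(x_n)$. Superregularity: $C$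 is $(\varepsilon,\delta)$-regular at $w$ if for all $x,y\in C\cap\mathbb{B}(w;\delta)$ and $u\in N^{\rm prox}_C(x)$ one has $\langle u,x-y\rangle\ge-\varepsilon\|u\|\,\|x-y\|$; $C$ is superregular at $w$ if for every $\varepsilon>0$ there is $\delta>0$ such that $C$ is $(\varepsilon,\delta)$-regular at $w$; a system is superregular at $w$ if each of its sets is. Strong regularity: $\{A,B\}$ is strongly regular at $w\in A\cap B$ if $N_A(w)\cap(-N_B(w))=\{0\}$. *)

theory Defs
  imports "HOL-Analysis.Analysis"
begin

(* Set-valued operators are functions 'a => 'a set.  A Euclidean space is a type of class
   euclidean_space, and d_C(x) is infdist x C; the junk value infdist x {} = 0 is irrelevant
   because the notions below are meant for nonempty closed sets. *)

definition projector :: "'a::euclidean_space set \<Rightarrow> 'a \<Rightarrow> 'a set" where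
  "projector C x = {c \<in> C. norm (x - c) = infdist x C}"

(* (1 - lam) Id + lam T *)
definition relaxation :: "real \<Rightarrow> ('a::real_vector \<Rightarrow> 'a set) \<Rightarrow> 'a \<Rightarrow> 'a set" where
  "relaxation lam T x = {(1 - lam) *\<^sub>R x + lam *\<^sub>R y |y. y \<in> T x}"

definition relaxed_projector :: "real \<Rightarrow> 'a::euclidean_space set \<Rightarrow> 'a \<Rightarrow> 'a set" where
  "relaxed_projector lam C = relaxation lam (projector C)"

definition set_valued_comp :: "('b \<Rightarrow> 'c set) \<Rightarrow> ('a \<Rightarrow> 'b set) \<Rightarrow> 'a \<Rightarrow> 'c set" where
  "set_valued_comp S T x = (\<Union>y\<in>T x. S y)"

(* (1 - alpha) Id + alpha P_B^mu P_A^lam: the projection onto A is applied first *)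
definition generalized_DR ::
  "real \<Rightarrow> real \<Rightarrow> real \<Rightarrow> 'a::euclidean_space set \<Rightarrow> 'a set \<Rightarrow> 'a \<Rightarrow> 'a set" where
  "generalized_DR alpha lam mu A B =
     relaxation alpha (set_valued_comp (relaxed_projector mu B) (relaxed_projector lam A))"

(* The operators are T 1, ..., T l, continued periodically to all indices k >= 1. *)
definition cyclic_extension :: "nat \<Rightarrow> (nat \<Rightarrow> 'b) \<Rightarrow> nat \<Rightarrow> 'b" where
  "cyclic_extension l T k = T ((k - 1) mod l + 1)"

lemma cyclic_extension_periodic:
  assumes "j \<in> {1..l}"
  shows "cyclic_extension l T (l * n + j) = T j"
proof -
  obtain i where i: "j = Suc i" "i < l"
    using assms by (cases j) auto
  then show ?thesis
    by (simp add: cyclic_extension_def)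
qed

definition cyclic_sequence :: "nat \<Rightarrow> (nat \<Rightarrow> 'a \<Rightarrow> 'a set) \<Rightarrow> (nat \<Rightarrow> 'a) \<Rightarrow> bool" where
  "cyclic_sequence l T x \<longleftrightarrow> (\<forall>n. x (n + 1) \<in> cyclic_extension l T (n + 1) (x n))"

definition R_linearly_converges_to :: "(nat \<Rightarrow> 'a::real_normed_vector) \<Rightarrow> 'a \<Rightarrow> bool" where
  "R_linearly_converges_to x xbar \<longleftrightarrow>
     (\<exists>\<rho> \<sigma>. 0 \<le> \<rho> \<and> \<rho> < 1 \<and> 0 \<le> \<sigma> \<and> (\<forall>n. norm (x n - xbar) \<le> \<sigma> * \<rho> ^ n))"

definition linearly_regular_around ::
  "'i set \<Rightarrow> ('i \<Rightarrow> 'a::euclidean_space set) \<Rightarrow> 'a \<Rightarrow> bool" where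
  "linearly_regular_around I C w \<longleftrightarrow>
     (\<exists>\<delta>>0. \<exists>\<kappa>>0. \<forall>x\<in>cball w \<delta>.
        infdist x (\<Inter>i\<in>I. C i) \<le> \<kappa> * (MAX i\<in>I. infdist x (C i)))"

definition prox_normal_cone :: "'a::euclidean_space set \<Rightarrow> 'a \<Rightarrow> 'a set" where
  "prox_normal_cone C x = {lam *\<^sub>R (z - x) |lam z. x \<in> projector C z \<and> lam \<ge> 0}"

definition limiting_normal_cone :: "'a::euclidean_space set \<Rightarrow> 'a \<Rightarrow> 'a set" where
  "limiting_normal_cone C x =
     {u. \<exists>xs us. xs \<longlonglongrightarrow> x \<and> us \<longlonglongrightarrow> u \<and>
           (\<forall>n. xs n \<in> C \<and> us n \<in> prox_normal_cone C (xs n))}"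

definition eps_delta_regular :: "real \<Rightarrow> real \<Rightarrow> 'a::euclidean_space set \<Rightarrow> 'a \<Rightarrow> bool" where
  "eps_delta_regular \<epsilon> \<delta> C w \<longleftrightarrow>
     (\<forall>x \<in> C \<inter> cball w \<delta>. \<forall>y \<in> C \<inter> cball w \<delta>. \<forall>u \<in> prox_normal_cone C x.
        inner u (x - y) \<ge> - \<epsilon> * norm u * norm (x - y))"

definition superregular_at :: "'a::euclidean_space set \<Rightarrow> 'a \<Rightarrow> bool" where
  "superregular_at C w \<longleftrightarrow> (\<forall>\<epsilon>>0. \<exists>\<delta>>0. eps_delta_regular \<epsilon> \<delta> C w)"

definition superregular_system_at ::
  "'i set \<Rightarrow> ('i \<Rightarrow> 'a::euclidean_space set) \<Rightarrow> 'a \<Rightarrow> bool" where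
  "superregular_system_at I C w \<longleftrightarrow> (\<forall>i\<in>I. superregular_at (C i) w)"

(* Meant for points w of A \<inter> B. *)
definition strongly_regular_at ::
  "'a::euclidean_space set \<Rightarrow> 'a set \<Rightarrow> 'a \<Rightarrow> bool" where
  "strongly_regular_at A B w \<longleftrightarrow>
     limiting_normal_cone A w \<inter> uminus ` limiting_normal_cone B w = {0}"

end

theory Submission
  imports Defs
begin

text \<open>
  Superregularity makes each relaxed projector, and hence each operator \<open>T\<^sub>j\<close>, almost nonexpansive
  with respect to points \<open>c\<close> of \<open>C\<close> near \<open>w\<close>; averaging with the identity gains a multiple of
  the squared step length:
  \<open>(norm (y - c))\<^sup>2 \<le> (1 + \<eta>) * (norm (x - c))\<^sup>2 - \<beta> * (norm (y - x))\<^sup>2\<close> for \<open>y \<in> T\<^sub>j x\<close>, where \<open>\<beta>\<close>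
  does not depend on \<open>\<eta>\<close>.  By compactness, strong regularity gives
  \<open>norm (u + v) \<ge> \<theta> * (norm u + norm v)\<close> for proximal normals \<open>u\<close>, \<open>v\<close> at points near \<open>w\<close>, so
  the step length dominates the distances from \<open>x\<close> to the two sets involved.  Over a whole
  cycle all distances to the \<open>C\<^sub>i\<close>, and by linear regularity the distance to \<open>C\<close>, are
  controlled by the steps made; for small \<open>\<eta>\<close> the distance to \<open>C\<close> therefore shrinks by a fixed
  factor per cycle, which also keeps the sequence near \<open>w\<close>.
\<close>

section \<open>Projections and proximal normals\<close>

lemma projector_bounds:
  assumes "a \<in> projector A x" "c \<in> A"
  shows "norm (x - a) \<le> norm (x - c)" and "norm (a - c) \<le> 2 * norm (x - c)"
proof -
  show 1: "norm (x - a) \<le> norm (x - c)"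
    using assms infdist_le[of c A x] by (simp add: projector_def dist_norm)
  have "norm (a - c) \<le> norm (x - a) + norm (x - c)"
    using norm_triangle_ineq[of "a - x" "x - c"] by (simp add: norm_minus_commute)
  with 1 show "norm (a - c) \<le> 2 * norm (x - c)" by simp
qed

lemma projector_nonempty:
  assumes "closed A" "A \<noteq> {}"
  obtains c where "c \<in> projector A x"
  using infdist_attains_inf[OF assms, of x] that
  by (metis (mono_tags, lifting) dist_norm mem_Collect_eq projector_def)

lemma prox_normal_coneI:
  assumes "a \<in> projector A x"
  shows "x - a \<in> prox_normal_cone A a"
  unfolding prox_normal_cone_def using assms
  by (intro CollectI exI[of _ 1] exI[of _ x]) auto

lemma prox_normal_cone_scale:
  assumes "u \<in> prox_normal_cone A a" "k \<ge> 0"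
  shows "k *\<^sub>R u \<in> prox_normal_cone A a"
proof -
  obtain l z where "u = l *\<^sub>R (z - a)" "a \<in> projector A z" "l \<ge> 0"
    using assms(1) unfolding prox_normal_cone_def by blast
  with assms(2) show ?thesis
    unfolding prox_normal_cone_def by (intro CollectI exI[of _ "k * l"] exI[of _ z]) auto
qed

lemma relaxed_projectorE:
  assumes "r \<in> relaxed_projector lam A x"
  obtains a where "a \<in> projector A x" "r = x + lam *\<^sub>R (a - x)"
  using assms unfolding relaxed_projector_def relaxation_def
  by (auto simp: algebra_simps)

text \<open>When the square is expanded, the term with \<open>lam * (2 - lam)\<close> has the right
  sign because \<open>lam \<le> 2\<close>. Regularity, applied to the normal \<open>x - a\<close>,
  bounds the inner product from below; with d the distance from \<open>x\<close> to
  \<open>c\<close>, the bounds \<open>norm (x - a) \<le> d\<close>,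
  \<open>norm (a - c) \<le> 2 * d\<close> and \<open>lam \<le> 2\<close> make the error at most
  \<open>8 * \<epsilon> * d * d\<close>.\<close>

lemma relaxed_projector_quasi_nonexpansive:
  assumes reg: "eps_delta_regular \<epsilon> \<delta> A w" and "\<epsilon> \<ge> 0" "lam \<in> {0<..2}"
    and a: "a \<in> projector A x" "a \<in> cball w \<delta>" and c: "c \<in> A" "c \<in> cball w \<delta>"
  shows "(norm (x + lam *\<^sub>R (a - x) - c))\<^sup>2 \<le> (1 + 8 * \<epsilon>) * (norm (x - c))\<^sup>2"
proof -
  let ?d = "norm (x - c)"
  have aA: "a \<in> A" using a by (simp add: projector_def)
  have inn: "inner (x - a) (a - c) \<ge> - \<epsilon> * norm (x - a) * norm (a - c)"
    using reg aA a(2) c prox_normal_coneI[OF a(1)] unfolding eps_delta_regular_def by blast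
  have "norm (x - a) * norm (a - c) \<le> ?d * (2 * ?d)"
    by (intro mult_mono projector_bounds[OF a(1) c(1)]) auto
  then have "\<epsilon> * (norm (x - a) * norm (a - c)) \<le> \<epsilon> * (2 * ?d\<^sup>2)"
    using \<open>\<epsilon> \<ge> 0\<close> by (intro mult_left_mono) (auto simp: power2_eq_square)
  with inn have "- inner (x - a) (a - c) \<le> 2 * \<epsilon> * ?d\<^sup>2" by (simp add: algebra_simps)
  then have "2 * lam * (- inner (x - a) (a - c)) \<le> 2 * lam * (2 * \<epsilon> * ?d\<^sup>2)"
    using assms(3) by (intro mult_left_mono) auto
  also have "\<dots> \<le> 4 * (2 * \<epsilon> * ?d\<^sup>2)"
    using assms(2,3) by (intro mult_right_mono) auto
  finally have 1: "- (2 * lam * inner (x - a) (a - c)) \<le> 8 * \<epsilon> * ?d\<^sup>2" by simp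
  have eq: "(norm (x + lam *\<^sub>R (a - x) - c))\<^sup>2
      = ?d\<^sup>2 - lam * (2 - lam) * (norm (x - a))\<^sup>2 - 2 * lam * inner (x - a) (a - c)"
    by (simp add: power2_norm_eq_inner inner_simps inner_commute algebra_simps)
  have "(1 + 8 * \<epsilon>) * ?d\<^sup>2 = ?d\<^sup>2 + 8 * \<epsilon> * ?d\<^sup>2" by (simp add: distrib_right)
  moreover have "lam * (2 - lam) * (norm (x - a))\<^sup>2 \<ge> 0" using assms(3) by auto
  ultimately show ?thesis using 1 unfolding eq by linarith
qed

text \<open>Pairs of normals of total length 1 lie in a compact set. If no constants worked, such
  pairs at base points tending to \<open>w\<close>, with sums tending to 0, would have limits
  \<open>u0\<close> and \<open>v0 = - u0\<close> in the two limiting cones at \<open>w\<close>;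
  strong regularity makes both vanish, against total length 1.\<close>

lemma strongly_regular_uniform:
  fixes A B :: "'a::euclidean_space set"
  assumes "strongly_regular_at A B w"
  obtains \<theta> \<delta> where "\<theta> > 0" "\<delta> > 0"
    "\<And>a b u v. \<lbrakk>a \<in> A \<inter> cball w \<delta>; b \<in> B \<inter> cball w \<delta>; u \<in> prox_normal_cone A a;
       v \<in> prox_normal_cone B b\<rbrakk> \<Longrightarrow> \<theta> * (norm u + norm v) \<le> norm (u + v)"
proof -
  \<comment> \<open>\<open>P n\<close> describes a normalised counterexample, with the same number
    \<open>1 / (n + 1)\<close> as radius and as constant. Excluding it for a single \<open>n\<close>
    yields both \<open>\<theta>\<close> and \<open>\<delta>\<close>; scaling inside the cones then
    removes the normalisation.\<close>
  define P where "P n a b u v \<longleftrightarrow> a \<in> A \<inter> cball w (inverse (real (Suc n))) \<and>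
     b \<in> B \<inter> cball w (inverse (real (Suc n))) \<and> u \<in> prox_normal_cone A a \<and>
     v \<in> prox_normal_cone B b \<and>
     norm u + norm v = 1 \<and> norm (u + v) < inverse (real (Suc n))" for n a b u v
  have "\<exists>n. \<forall>a b u v. \<not> P n a b u v"
  proof (rule ccontr)
    assume "\<not> ?thesis"
    then obtain a b u v where P: "\<And>n. P n (a n) (b n) (u n) (v n)"
      by metis
    have "norm (u n) \<le> 1" "norm (v n) \<le> 1" for n
      using P[of n] norm_ge_zero[of "u n"] norm_ge_zero[of "v n"]
      unfolding P_def by linarith+
    then have "\<And>n. (u n, v n) \<in> cball 0 1 \<times> cball 0 1" by auto
    then obtain uv f where f: "strict_mono f" "((\<lambda>n. (u n, v n)) \<circ> f) \<longlonglongrightarrow> uv"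
      using seq_compactE[OF compact_imp_seq_compact[OF
          compact_Times[OF compact_cball compact_cball, of "0::'a" 1 "0::'a" 1]],
          of "\<lambda>n. (u n, v n)"] by blast
    obtain u0 v0 where uv: "uv = (u0, v0)" by force
    have u: "(u \<circ> f) \<longlonglongrightarrow> u0" and v: "(v \<circ> f) \<longlonglongrightarrow> v0"
      using tendsto_fst[OF f(2)] tendsto_snd[OF f(2)] by (auto simp: uv o_def)
    have sub: "(\<lambda>n. inverse (real (Suc (f n)))) \<longlonglongrightarrow> 0"
      using LIMSEQ_subseq_LIMSEQ[OF LIMSEQ_inverse_real_of_nat f(1)] by (simp add: o_def)
    have a: "(a \<circ> f) \<longlonglongrightarrow> w" and b: "(b \<circ> f) \<longlonglongrightarrow> w"
      unfolding tendsto_dist_iff[of _ w] o_def using P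
      by (auto intro!: tendsto_sandwich[OF _ _ tendsto_const sub]
          simp: P_def dist_commute)
    have "u0 + v0 = 0"
    proof -
      have "(\<lambda>n. norm (u (f n) + v (f n))) \<longlonglongrightarrow> 0"
        using P by (auto intro!: tendsto_sandwich[OF _ _ tendsto_const sub] always_eventually
            simp: P_def less_imp_le)
      moreover have "(\<lambda>n. norm (u (f n) + v (f n))) \<longlonglongrightarrow> norm (u0 + v0)"
        using u v by (auto intro!: tendsto_intros simp: o_def)
      ultimately show ?thesis using LIMSEQ_unique by fastforce
    qed
    then have v0: "u0 = - v0" by (simp add: eq_neg_iff_add_eq_0)
    have "(\<lambda>n. norm (u (f n)) + norm (v (f n))) \<longlonglongrightarrow> norm u0 + norm v0"
      using u v by (auto intro!: tendsto_intros simp: o_def)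
    then have one: "norm u0 + norm v0 = 1"
      using P by (simp add: P_def LIMSEQ_const_iff)
    have "u0 \<in> limiting_normal_cone A w"
      unfolding limiting_normal_cone_def using a u P
      by (intro CollectI exI[of _ "a \<circ> f"] exI[of _ "u \<circ> f"]) (auto simp: P_def)
    moreover have "v0 \<in> limiting_normal_cone B w"
      unfolding limiting_normal_cone_def using b v P
      by (intro CollectI exI[of _ "b \<circ> f"] exI[of _ "v \<circ> f"]) (auto simp: P_def)
    ultimately have "u0 = 0"
      using assms v0 unfolding strongly_regular_at_def by blast
    with v0 one show False by simp
  qed
  then obtain n where n: "\<And>a b u v. \<not> P n a b u v" by blast
  let ?d = "inverse (real (Suc n))"
  show ?thesis
  proof (rule that[of ?d ?d])
    fix a b u v
    assume h: "a \<in> A \<inter> cball w ?d" "b \<in> B \<inter> cball w ?d" "u \<in> prox_normal_cone A a"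
      "v \<in> prox_normal_cone B b"
    define N where "N = norm u + norm v"
    show "?d * (norm u + norm v) \<le> norm (u + v)"
    proof (cases "N = 0")
      case False
      then have N: "N > 0" unfolding N_def by (metis add_nonneg_nonneg norm_ge_zero order_le_less)
      have "\<not> P n a b (inverse N *\<^sub>R u) (inverse N *\<^sub>R v)" by (rule n)
      moreover have "norm (inverse N *\<^sub>R u) + norm (inverse N *\<^sub>R v) = 1"
        using N unfolding N_def by (simp add: divide_simps)
      ultimately have "\<not> norm (inverse N *\<^sub>R u + inverse N *\<^sub>R v) < ?d"
        using h N unfolding P_def by (auto intro: prox_normal_cone_scale)
      then have "?d \<le> norm (u + v) / N"
        using N by (simp add: scaleR_add_right[symmetric] divide_inverse mult.commute
            del: scaleR_add_right)
      with N show ?thesis unfolding N_def[symmetric] by (simp add: pos_le_divide_eq)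
    qed (auto simp: N_def)
  qed auto
qed

section \<open>One step and one cycle\<close>

text \<open>\<open>\<beta>\<close> and \<open>K\<close> are quantified before \<open>\<eta>\<close>
  so that the growth can later be chosen small relative to them; only the radius
  \<open>\<delta>\<close> depends on \<open>\<eta>\<close>.\<close>

lemma generalized_DR_step:
  fixes A B :: "'a::euclidean_space set"
  assumes w: "w \<in> A" "w \<in> B"
    and lam: "lam \<in> {0<..2}" and mu: "mu \<in> {0<..2}" and alpha: "alpha \<in> {0<..<1}"
    and reg: "superregular_at A w" "superregular_at B w" "strongly_regular_at A B w"
  shows "\<exists>\<beta>>0. \<exists>K>0. \<forall>\<eta>>0. \<exists>\<delta>>0. \<forall>x\<in>cball w \<delta>. \<forall>y\<in>generalized_DR alpha lam mu A B x.
       (\<forall>c\<in>A \<inter> B \<inter> cball w \<delta>.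
          (norm (y - c))\<^sup>2 \<le> (1 + \<eta>) * (norm (x - c))\<^sup>2 - \<beta> * (norm (y - x))\<^sup>2) \<and>
       infdist x A \<le> K * norm (y - x) \<and> infdist x B \<le> K * norm (y - x)"
proof -
  obtain \<theta> \<delta>0 where \<theta>: "\<theta> > 0" and \<delta>0: "\<delta>0 > 0"
    and strong: "\<And>a b u v. \<lbrakk>a \<in> A \<inter> cball w \<delta>0; b \<in> B \<inter> cball w \<delta>0; u \<in> prox_normal_cone A a;
       v \<in> prox_normal_cone B b\<rbrakk> \<Longrightarrow> \<theta> * (norm u + norm v) \<le> norm (u + v)"
    using strongly_regular_uniform[OF reg(3)] by metis
  \<comment> \<open>Since \<open>y - x = alpha * (q - x)\<close>, the averaging gain
    \<open>alpha * (1 - alpha)\<close> times the square of \<open>norm (q - x)\<close> is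
    \<open>\<beta>\<close> times the squared step length.\<close>
  define \<beta> where "\<beta> = (1 - alpha) / alpha"
  \<comment> \<open>The bound \<open>coer\<close> below controls
    \<open>lam * norm (x - a) + mu * norm (r - b)\<close>. The distance to \<open>A\<close> is
    \<open>norm (x - a)\<close>, and that to \<open>B\<close> is at most
    \<open>lam * norm (x - a) + norm (r - b)\<close>; the factor \<open>1 + 1 / lam + 1 / mu\<close>
    covers both.\<close>
  define K where "K = (1 + 1 / lam + 1 / mu) / (alpha * \<theta>)"
  have pos: "lam > 0" "mu > 0" "alpha > 0" "alpha < 1" using lam mu alpha by auto
  have "\<beta> > 0" using pos by (simp add: \<beta>_def)
  have "K > 0" unfolding K_def using pos \<theta> by (intro divide_pos_pos add_pos_pos mult_pos_pos) auto
  show ?thesis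
  proof (rule exI[of _ \<beta>], rule conjI[OF \<open>\<beta> > 0\<close>], rule exI[of _ K],
      rule conjI[OF \<open>K > 0\<close>], intro allI impI)
    fix \<eta> :: real assume "\<eta> > 0"
    \<comment> \<open>Two relaxed projections contribute
      \<open>1 + 16 * \<epsilon> + 64 * \<epsilon> * \<epsilon>\<close>, which is at most
      \<open>1 + 80 * \<epsilon>\<close> when \<open>\<epsilon> \<le> 1\<close>.\<close>
    define \<epsilon> where "\<epsilon> = min 1 (\<eta> / 80)"
    have \<epsilon>: "\<epsilon> > 0" "\<epsilon> \<le> 1" "80 * \<epsilon> \<le> \<eta>" using \<open>\<eta> > 0\<close> by (auto simp: \<epsilon>_def)
    obtain \<delta>1 \<delta>2 where \<delta>12: "\<delta>1 > 0" "\<delta>2 > 0"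
      and regA: "eps_delta_regular \<epsilon> \<delta>1 A w" and regB: "eps_delta_regular \<epsilon> \<delta>2 B w"
      using reg(1,2) \<epsilon>(1) unfolding superregular_at_def by metis
    \<comment> \<open>Projecting at most doubles the distance to \<open>w\<close>. For
      \<open>x\<close> within \<open>\<delta>\<close>, the point \<open>a\<close> lies within
      \<open>2 * \<delta>\<close>, \<open>r\<close> within \<open>3 * \<delta>\<close> because
      \<open>lam \<le> 2\<close>, and \<open>b\<close> within \<open>6 * \<delta>\<close>.\<close>
    define \<delta> where "\<delta> = min \<delta>0 (min \<delta>1 \<delta>2) / 6"
    have \<delta>: "\<delta> > 0" "6 * \<delta> \<le> \<delta>0" "6 * \<delta> \<le> \<delta>1" "6 * \<delta> \<le> \<delta>2"
      using \<delta>0 \<delta>12 by (auto simp: \<delta>_def)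
    show "\<exists>\<delta>>0. \<forall>x\<in>cball w \<delta>. \<forall>y\<in>generalized_DR alpha lam mu A B x.
       (\<forall>c\<in>A \<inter> B \<inter> cball w \<delta>.
          (norm (y - c))\<^sup>2 \<le> (1 + \<eta>) * (norm (x - c))\<^sup>2 - \<beta> * (norm (y - x))\<^sup>2) \<and>
       infdist x A \<le> K * norm (y - x) \<and> infdist x B \<le> K * norm (y - x)"
    proof (intro exI[of _ \<delta>] conjI[OF \<open>\<delta> > 0\<close>] ballI)
      fix x y assume x: "x \<in> cball w \<delta>" and "y \<in> generalized_DR alpha lam mu A B x"
      then obtain q where q: "q \<in> set_valued_comp (relaxed_projector mu B) (relaxed_projector lam A) x"
        and y0: "y = (1 - alpha) *\<^sub>R x + alpha *\<^sub>R q"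
        unfolding generalized_DR_def relaxation_def by blast
      from q obtain r where r: "r \<in> relaxed_projector lam A x" and qr: "q \<in> relaxed_projector mu B r"
        unfolding set_valued_comp_def by blast
      from r obtain a where a: "a \<in> projector A x" and r: "r = x + lam *\<^sub>R (a - x)"
        by (rule relaxed_projectorE)
      from qr obtain b where b: "b \<in> projector B r" and q: "q = r + mu *\<^sub>R (b - r)"
        by (rule relaxed_projectorE)
      have aA: "a \<in> A" and bB: "b \<in> B" using a b by (auto simp: projector_def)
      have xw: "norm (x - w) \<le> \<delta>" using x by (simp add: dist_norm norm_minus_commute)
      have aw: "norm (a - w) \<le> 2 * \<delta>" using projector_bounds(2)[OF a w(1)] xw by simp
      have "norm (r - w) \<le> norm (x - w) + lam * norm (x - a)"
        using norm_triangle_ineq[of "x - w" "lam *\<^sub>R (a - x)"] pos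
        by (simp add: r norm_minus_commute[of a x] add_diff_eq diff_add_eq)
      also have "\<dots> \<le> \<delta> + 2 * \<delta>"
        using projector_bounds(1)[OF a w(1)] xw lam by (intro add_mono mult_mono) auto
      finally have rw: "norm (r - w) \<le> 3 * \<delta>" by simp
      have bw: "norm (b - w) \<le> 6 * \<delta>" using projector_bounds(2)[OF b w(2)] rw by simp
      have a1: "a \<in> cball w \<delta>0" "a \<in> cball w \<delta>1" and b1: "b \<in> cball w \<delta>0" "b \<in> cball w \<delta>2"
        using aw bw \<delta> by (auto simp: dist_norm norm_minus_commute)
      have yx: "y - x = alpha *\<^sub>R (q - x)" by (simp add: y0 algebra_simps)
      have nyx: "norm (y - x) = alpha * norm (q - x)" using pos by (simp add: yx)
      \<comment> \<open>\<open>x - q\<close> is the sum of a proximal normal to \<open>A\<close> at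
        \<open>a\<close> and one to \<open>B\<close> at \<open>b\<close>, so strong regularity keeps
        the two displacements from cancelling.\<close>
      have coer: "alpha * \<theta> * (lam * norm (x - a) + mu * norm (r - b)) \<le> norm (y - x)"
      proof -
        have "\<theta> * (norm (lam *\<^sub>R (x - a)) + norm (mu *\<^sub>R (r - b)))
            \<le> norm (lam *\<^sub>R (x - a) + mu *\<^sub>R (r - b))"
          using strong[of a b "lam *\<^sub>R (x - a)" "mu *\<^sub>R (r - b)"] a1 b1 aA bB pos
            prox_normal_cone_scale[OF prox_normal_coneI[OF a], of lam]
            prox_normal_cone_scale[OF prox_normal_coneI[OF b], of mu] by auto
        also have "lam *\<^sub>R (x - a) + mu *\<^sub>R (r - b) = - (q - x)"
          by (simp add: q r algebra_simps)
        finally have "\<theta> * (lam * norm (x - a) + mu * norm (r - b)) \<le> norm (q - x)"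
          using pos by (simp add: norm_minus_commute)
        then show ?thesis using pos by (simp add: nyx mult.assoc)
      qed
      let ?S = "lam * norm (x - a) + mu * norm (r - b)"
      have S: "?S \<le> norm (y - x) / (alpha * \<theta>)"
        using coer pos \<theta> by (simp add: pos_le_divide_eq mult.commute)
      have SK: "(1 + 1 / lam + 1 / mu) * ?S \<le> K * norm (y - x)"
        using mult_left_mono[OF S, of "1 + 1 / lam + 1 / mu"] pos by (simp add: K_def)
      have expand: "(1 + 1 / lam + 1 / mu) * ?S
          = lam * norm (x - a) + mu * norm (r - b) + norm (x - a) + mu * norm (r - b) / lam
            + lam * norm (x - a) / mu + norm (r - b)"
        using pos by (simp add: field_simps)
      have nonneg: "lam * norm (x - a) \<ge> 0" "mu * norm (r - b) \<ge> 0"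
        "mu * norm (r - b) / lam \<ge> 0" "lam * norm (x - a) / mu \<ge> 0"
        using pos by auto
      have "infdist x A = norm (x - a)" using a by (simp add: projector_def)
      then have dA: "infdist x A \<le> K * norm (y - x)"
        using SK nonneg norm_ge_zero[of "r - b"] unfolding expand by linarith
      have "infdist x B \<le> norm (x - b)" using infdist_le[OF bB, of x] by (simp add: dist_norm)
      also have "\<dots> \<le> norm (x - r) + norm (r - b)"
        using norm_triangle_ineq[of "x - r" "r - b"] by simp
      also have "norm (x - r) = lam * norm (x - a)"
        using pos by (simp add: r norm_minus_commute)
      finally have dB: "infdist x B \<le> K * norm (y - x)"
        using SK nonneg norm_ge_zero[of "x - a"] unfolding expand by linarith
      have "(norm (y - c))\<^sup>2 \<le> (1 + \<eta>) * (norm (x - c))\<^sup>2 - \<beta> * (norm (y - x))\<^sup>2"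
        if c: "c \<in> A \<inter> B \<inter> cball w \<delta>" for c
      proof -
        have c1: "c \<in> cball w \<delta>1" "c \<in> cball w \<delta>2" using c \<delta> by auto
        have 1: "(norm (r - c))\<^sup>2 \<le> (1 + 8 * \<epsilon>) * (norm (x - c))\<^sup>2"
          unfolding r using relaxed_projector_quasi_nonexpansive[OF regA _ lam a a1(2)] c c1 \<epsilon> by simp
        have 2: "(norm (q - c))\<^sup>2 \<le> (1 + 8 * \<epsilon>) * (norm (r - c))\<^sup>2"
          unfolding q using relaxed_projector_quasi_nonexpansive[OF regB _ mu b b1(2)] c c1 \<epsilon> by simp
        also have "\<dots> \<le> (1 + 8 * \<epsilon>) * ((1 + 8 * \<epsilon>) * (norm (x - c))\<^sup>2)"
          using 1 \<epsilon> by (intro mult_left_mono) auto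
        also have "\<dots> = (1 + 16 * \<epsilon> + 64 * (\<epsilon> * \<epsilon>)) * (norm (x - c))\<^sup>2"
          by (simp add: algebra_simps)
        also have "\<dots> \<le> (1 + \<eta>) * (norm (x - c))\<^sup>2"
        proof (intro mult_right_mono)
          have "\<epsilon> * \<epsilon> \<le> \<epsilon>" using \<epsilon> by (simp add: mult_left_le)
          then show "1 + 16 * \<epsilon> + 64 * (\<epsilon> * \<epsilon>) \<le> 1 + \<eta>" using \<epsilon> by linarith
        qed auto
        finally have qc: "(norm (q - c))\<^sup>2 \<le> (1 + \<eta>) * (norm (x - c))\<^sup>2" .
        have "(norm (y - c))\<^sup>2 = (1 - alpha) * (norm (x - c))\<^sup>2 + alpha * (norm (q - c))\<^sup>2
            - alpha * (1 - alpha) * (norm (q - x))\<^sup>2"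
          by (simp add: y0 power2_norm_eq_inner inner_simps inner_commute algebra_simps)
        also have "alpha * (1 - alpha) * (norm (q - x))\<^sup>2 = \<beta> * (norm (y - x))\<^sup>2"
          using pos by (simp add: \<beta>_def nyx power2_eq_square field_simps)
        also have "(1 - alpha) * (norm (x - c))\<^sup>2 + alpha * (norm (q - c))\<^sup>2
            \<le> (1 - alpha) * ((1 + \<eta>) * (norm (x - c))\<^sup>2) + alpha * ((1 + \<eta>) * (norm (x - c))\<^sup>2)"
          using pos qc \<open>\<eta> > 0\<close> by (intro add_mono mult_left_mono) (auto simp: mult_le_cancel_right1)
        finally show ?thesis by (simp add: algebra_simps)
      qed
      with dA dB show "(\<forall>c\<in>A \<inter> B \<inter> cball w \<delta>.
          (norm (y - c))\<^sup>2 \<le> (1 + \<eta>) * (norm (x - c))\<^sup>2 - \<beta> * (norm (y - x))\<^sup>2) \<and>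
          infdist x A \<le> K * norm (y - x) \<and> infdist x B \<le> K * norm (y - x)"
        by blast
    qed
  qed
qed

text \<open>One comparison point, nearest to the start of the cycle, serves for the whole cycle. The
  step estimate is assumed only inside the ball of radius \<open>\<delta>\<close>, so the induction
  shows along the way that the iterates stay there; starting within a quarter of the radius leaves
  room for this.\<close>

lemma quasi_Fejer_cycle:
  fixes z :: "nat \<Rightarrow> 'a::euclidean_space"
  assumes c: "c \<in> projector S (z 0)" and w: "w \<in> S" and z0: "norm (z 0 - w) \<le> \<delta> / 4"
    and \<eta>: "\<eta> \<ge> 0" "(1 + \<eta>) ^ l \<le> 4" and \<beta>: "\<beta> \<ge> 0"
    and step: "\<And>k. \<lbrakk>k < l; z k \<in> cball w \<delta>; c \<in> cball w \<delta>\<rbrakk> \<Longrightarrow>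
       (norm (z (Suc k) - c))\<^sup>2 \<le> (1 + \<eta>) * (norm (z k - c))\<^sup>2 - \<beta> * (norm (z (Suc k) - z k))\<^sup>2"
    and k: "k \<le> l"
  shows "z k \<in> cball w \<delta>" and "norm (z k - z 0) \<le> 3 * infdist (z 0) S"
    and "(norm (z k - c))\<^sup>2 \<le> (1 + \<eta>) ^ k * (infdist (z 0) S)\<^sup>2
           - \<beta> * (\<Sum>i<k. (norm (z (Suc i) - z i))\<^sup>2)"
proof -
  let ?D = "infdist (z 0) S"
  have D: "norm (z 0 - c) = ?D" using c by (simp add: projector_def)
  have Dw: "?D \<le> norm (z 0 - w)" using infdist_le[OF w, of "z 0"] by (simp add: dist_norm)
  have cw: "c \<in> cball w \<delta>"
    using projector_bounds(2)[OF c w] z0 norm_ge_zero[of "z 0 - w"]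
    by (simp add: dist_norm norm_minus_commute del: norm_ge_zero)
  \<comment> \<open>Stated as an implication so that the induction can use it at \<open>k\<close>
    before taking the next step. Dropping the gain and using \<open>(1 + \<eta>) ^ k \<le> 4\<close>
    gives \<open>norm (z k - c) \<le> 2 * ?D\<close>, hence a displacement of at most
    \<open>3 * ?D\<close>, where \<open>?D \<le> \<delta> / 4\<close>.\<close>
  have main: "(norm (z k - c))\<^sup>2 \<le> (1 + \<eta>) ^ k * ?D\<^sup>2 - \<beta> * (\<Sum>i<k. (norm (z (Suc i) - z i))\<^sup>2)
      \<Longrightarrow> norm (z k - z 0) \<le> 3 * ?D \<and> z k \<in> cball w \<delta>" if "k \<le> l" for k
  proof -
    assume h: "(norm (z k - c))\<^sup>2 \<le> (1 + \<eta>) ^ k * ?D\<^sup>2 - \<beta> * (\<Sum>i<k. (norm (z (Suc i) - z i))\<^sup>2)"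
    have "\<beta> * (\<Sum>i<k. (norm (z (Suc i) - z i))\<^sup>2) \<ge> 0" using \<beta> by (simp add: sum_nonneg)
    with h have "(norm (z k - c))\<^sup>2 \<le> (1 + \<eta>) ^ k * ?D\<^sup>2" by simp
    also have "\<dots> \<le> 4 * ?D\<^sup>2"
      using power_increasing[OF that, of "1 + \<eta>"] \<eta> by (intro mult_right_mono) auto
    also have "\<dots> = (2 * ?D)\<^sup>2" by (simp add: power2_eq_square)
    finally have 1: "norm (z k - c) \<le> 2 * ?D"
      using infdist_nonneg by (metis power2_le_imp_le mult_nonneg_nonneg zero_le_numeral)
    have 2: "norm (z k - z 0) \<le> 3 * ?D"
      using norm_triangle_ineq4[of "z k - c" "z 0 - c"] 1 D by simp
    have "norm (z k - w) \<le> norm (z k - z 0) + norm (z 0 - w)"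
      using norm_triangle_ineq[of "z k - z 0" "z 0 - w"] by simp
    with 2 Dw z0 have "norm (z k - w) \<le> \<delta>" by linarith
    with 2 show ?thesis by (simp add: dist_norm norm_minus_commute)
  qed
  have bnd: "(norm (z k - c))\<^sup>2 \<le> (1 + \<eta>) ^ k * ?D\<^sup>2 - \<beta> * (\<Sum>i<k. (norm (z (Suc i) - z i))\<^sup>2)"
    if "k \<le> l" for k
    using that
  proof (induction k)
    case 0
    then show ?case by (simp add: D)
  next
    case (Suc k)
    let ?R = "\<Sum>i<k. (norm (z (Suc i) - z i))\<^sup>2"
    have IH: "(norm (z k - c))\<^sup>2 \<le> (1 + \<eta>) ^ k * ?D\<^sup>2 - \<beta> * ?R" using Suc by simp
    have "z k \<in> cball w \<delta>" using main[of k] IH Suc by simp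
    then have "(norm (z (Suc k) - c))\<^sup>2
        \<le> (1 + \<eta>) * (norm (z k - c))\<^sup>2 - \<beta> * (norm (z (Suc k) - z k))\<^sup>2"
      using step[of k] cw Suc by simp
    also have "(1 + \<eta>) * (norm (z k - c))\<^sup>2 \<le> (1 + \<eta>) * ((1 + \<eta>) ^ k * ?D\<^sup>2 - \<beta> * ?R)"
      using IH \<eta> by (intro mult_left_mono) auto
    \<comment> \<open>The factor \<open>1 + \<eta>\<close> also enlarges the earlier gains; the
      surplus is given away so that all gains keep the coefficient \<open>\<beta>\<close>.\<close>
    also have "\<dots> = (1 + \<eta>) ^ Suc k * ?D\<^sup>2 - \<beta> * ?R - \<eta> * (\<beta> * ?R)" by (simp add: algebra_simps)
    also have "\<dots> \<le> (1 + \<eta>) ^ Suc k * ?D\<^sup>2 - \<beta> * ?R"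
      using \<eta> \<beta> by (simp add: sum_nonneg)
    finally show ?case by (simp add: algebra_simps)
  qed
  show "z k \<in> cball w \<delta>" "norm (z k - z 0) \<le> 3 * ?D"
    "(norm (z k - c))\<^sup>2 \<le> (1 + \<eta>) ^ k * ?D\<^sup>2 - \<beta> * (\<Sum>i<k. (norm (z (Suc i) - z i))\<^sup>2)"
    using main[OF k] bnd[OF k] by auto
qed

text \<open>In the factor \<open>1 + K\<close>, the 1 accounts for the way from \<open>z 0\<close>
  to \<open>z k\<close> and the \<open>K\<close> for the distance remaining at \<open>z k\<close>,
  both measured by the length of the path. Cauchy-Schwarz passes to squared steps at the cost of a
  factor \<open>l\<close>.\<close>

lemma infdist_le_path_length:
  fixes z :: "nat \<Rightarrow> 'a::euclidean_space"
  assumes "k < l" "infdist (z k) A \<le> K * norm (z (Suc k) - z k)" "K \<ge> 0"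
  shows "(infdist (z 0) A)\<^sup>2 \<le> (1 + K)\<^sup>2 * real l * (\<Sum>i<l. (norm (z (Suc i) - z i))\<^sup>2)"
proof -
  let ?s = "\<lambda>i. norm (z (Suc i) - z i)"
  have "z k - z 0 = (\<Sum>i<k. z (Suc i) - z i)" by (simp add: sum_lessThan_telescope)
  then have 1: "norm (z k - z 0) \<le> (\<Sum>i<k. ?s i)" by (simp add: norm_sum)
  have "(\<Sum>i<k. ?s i) \<le> (\<Sum>i<l. ?s i)" using assms(1) by (intro sum_mono2) auto
  moreover have "?s k \<le> (\<Sum>i<l. ?s i)" using assms(1) by (intro member_le_sum) auto
  then have "K * ?s k \<le> K * (\<Sum>i<l. ?s i)" using assms(3) by (rule mult_left_mono)
  moreover have "infdist (z 0) A \<le> infdist (z k) A + dist (z 0) (z k)" by (rule infdist_triangle)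
  ultimately have "infdist (z 0) A \<le> (1 + K) * (\<Sum>i<l. ?s i)"
    using 1 assms(2) by (simp add: dist_norm norm_minus_commute algebra_simps)
  then have "(infdist (z 0) A)\<^sup>2 \<le> ((1 + K) * (\<Sum>i<l. ?s i))\<^sup>2"
    by (intro power_mono infdist_nonneg)
  also have "\<dots> = (1 + K)\<^sup>2 * (\<Sum>i<l. ?s i)\<^sup>2" by (simp add: power_mult_distrib)
  also have "\<dots> \<le> (1 + K)\<^sup>2 * (real l * (\<Sum>i<l. (?s i)\<^sup>2))"
    using sum_squared_le_sum_of_squares[of ?s "{..<l}"]
    by (intro mult_left_mono) (auto simp: mult.commute)
  finally show ?thesis by (simp add: mult.assoc)
qed

section \<open>Convergence\<close>

text \<open>The contraction is available only while a cycle starts within \<open>\<delta>\<close> of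
  \<open>w\<close>. Each cycle moves by at most three times a geometrically decaying distance, in
  total by at most \<open>3 * r / (1 - \<rho>)\<close>, so the condition on \<open>r\<close> keeps
  every cycle start in range.\<close>

lemma R_linear_convergence_of_cycles:
  fixes x :: "nat \<Rightarrow> 'a::euclidean_space"
  assumes S: "closed S" "w \<in> S" and l: "l > 0" and \<rho>: "0 < \<rho>" "\<rho> < 1"
    and x0: "norm (x 0 - w) \<le> r" and r: "r + 3 * r / (1 - \<rho>) \<le> \<delta>"
    and cycle: "\<And>n. norm (x (l * n) - w) \<le> \<delta> \<Longrightarrow>
       (\<forall>k\<le>l. norm (x (l * n + k) - x (l * n)) \<le> 3 * infdist (x (l * n)) S) \<and>
       infdist (x (l * n + l)) S \<le> \<rho> * infdist (x (l * n)) S"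
  shows "\<exists>xbar\<in>S. R_linearly_converges_to x xbar"
proof -
  define y where "y n = x (l * n)" for n
  have r0: "r \<ge> 0" using x0 norm_ge_zero order_trans by blast
  have geo: "(\<Sum>i<n. \<rho> ^ i) \<le> 1 / (1 - \<rho>)" for n
    using \<rho> by (simp add: sum_gp_strict divide_right_mono)
  \<comment> \<open>The two bounds depend on each other: the location makes \<open>cycle\<close>
    applicable, and the decay limits the next displacement.\<close>
  have y: "infdist (y n) S \<le> \<rho> ^ n * r \<and> norm (y n - w) \<le> r + 3 * r * (\<Sum>i<n. \<rho> ^ i)" for n
  proof (induction n)
    case 0
    have "infdist (x 0) S \<le> norm (x 0 - w)" using infdist_le[OF S(2), of "x 0"] by (simp add: dist_norm)
    then show ?case using x0 by (simp add: y_def)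
  next
    case (Suc n)
    have "3 * r * (\<Sum>i<n. \<rho> ^ i) \<le> 3 * r * (1 / (1 - \<rho>))"
      using geo r0 by (intro mult_left_mono) auto
    with Suc r have "norm (y n - w) \<le> \<delta>" by simp
    from cycle[of n, folded y_def, OF this]
    have 1: "norm (y (Suc n) - y n) \<le> 3 * infdist (y n) S" "infdist (y (Suc n)) S \<le> \<rho> * infdist (y n) S"
      by (auto simp: y_def algebra_simps)
    have "\<rho> * infdist (y n) S \<le> \<rho> * (\<rho> ^ n * r)" using Suc \<rho> by (intro mult_left_mono) auto
    moreover have "norm (y (Suc n) - w) \<le> norm (y (Suc n) - y n) + norm (y n - w)"
      using norm_triangle_ineq[of "y (Suc n) - y n" "y n - w"] by simp
    ultimately show ?case using 1 Suc by (simp add: algebra_simps)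
  qed
  have near: "norm (y n - w) \<le> \<delta>" for n
  proof -
    have "3 * r * (\<Sum>i<n. \<rho> ^ i) \<le> 3 * r * (1 / (1 - \<rho>))"
      using geo r0 by (intro mult_left_mono) auto
    with y[of n] r show ?thesis by simp
  qed
  have inner: "norm (x (l * n + k) - y n) \<le> 3 * r * \<rho> ^ n" if "k \<le> l" for n k
  proof -
    have "norm (x (l * n + k) - y n) \<le> 3 * infdist (y n) S"
      using cycle[OF near[of n, unfolded y_def]] that by (simp add: y_def)
    with y[of n] show ?thesis by (simp add: mult_ac)
  qed
  have diff: "norm (y (Suc n) - y n) \<le> 3 * r * \<rho> ^ n" for n
    using inner[of l n] by (simp add: y_def algebra_simps)
  have summ: "summable (\<lambda>n. 3 * r * \<rho> ^ n)" using \<rho> by (intro summable_mult summable_geometric) auto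
  have sn: "summable (\<lambda>i. y (Suc i) - y i)"
    by (rule summable_comparison_test[OF _ summ]) (use diff in auto)
  \<comment> \<open>With the limit written as a series of displacements, its distance from
    \<open>y n\<close> is the norm of a tail dominated by a geometric series.\<close>
  define xbar where "xbar = y 0 + (\<Sum>i. y (Suc i) - y i)"
  have lim: "y \<longlonglongrightarrow> xbar"
  proof -
    have "(\<lambda>n. y 0 + (\<Sum>i<n. y (Suc i) - y i)) \<longlonglongrightarrow> xbar"
      unfolding xbar_def using summable_LIMSEQ[OF sn] by (intro tendsto_intros)
    then show ?thesis by (simp add: sum_lessThan_telescope)
  qed
  have dist: "norm (y n - xbar) \<le> 3 * r / (1 - \<rho>) * \<rho> ^ n" for n
  proof -
    have "(\<lambda>i. y (Suc i) - y i) sums (xbar - y 0)"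
      using summable_sums[OF sn] by (simp add: xbar_def)
    from sums_split_initial_segment[OF this, of n] have s: "(\<lambda>i. y (Suc (i + n)) - y (i + n)) sums (xbar - y n)"
      by (simp add: sum_lessThan_telescope)
    have g: "(\<lambda>i. 3 * r * \<rho> ^ n * \<rho> ^ i) sums (3 * r * \<rho> ^ n * (1 / (1 - \<rho>)))"
      using \<rho> by (intro sums_mult geometric_sums) auto
    have "norm (\<Sum>i. y (Suc (i + n)) - y (i + n)) \<le> (\<Sum>i. 3 * r * \<rho> ^ n * \<rho> ^ i)"
      using diff[of "_ + n"]
      by (intro norm_suminf_le sums_summable[OF g]) (simp add: power_add algebra_simps)
    then show ?thesis
      using sums_unique[OF s] sums_unique[OF g] by (simp add: norm_minus_commute)
  qed
  have "xbar \<in> S"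
  proof -
    have "(\<lambda>n. infdist (y n) S) \<longlonglongrightarrow> infdist xbar S" using lim by (intro tendsto_intros)
    moreover have "(\<lambda>n. infdist (y n) S) \<longlonglongrightarrow> 0"
    proof (rule tendsto_sandwich[OF _ _ tendsto_const])
      show "(\<lambda>n. \<rho> ^ n * r) \<longlonglongrightarrow> 0"
        using \<rho> by (auto intro!: tendsto_mult_left_zero LIMSEQ_realpow_zero)
    qed (use y in \<open>auto simp: infdist_nonneg\<close>)
    ultimately have "infdist xbar S = 0" using LIMSEQ_unique by blast
    then show ?thesis using S in_closed_iff_infdist_zero by blast
  qed
  \<comment> \<open>This spreads the factor \<open>\<rho>\<close> of a full cycle evenly over its
    \<open>l\<close> steps.\<close>
  define \<tau> where "\<tau> = root l \<rho>"
  have \<tau>: "\<tau> ^ l = \<rho>" "0 < \<tau>" "\<tau> < 1" using \<rho> l by (auto simp: \<tau>_def)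
  \<comment> \<open>The summands bound the deviation inside a cycle and the distance of its start
    from \<open>xbar\<close>. Dividing by \<open>\<rho>\<close> pays for an unfinished cycle:
    \<open>\<rho> ^ (n div l + 1) \<le> \<tau> ^ n\<close>.\<close>
  define M where "M = (3 * r + 3 * r / (1 - \<rho>)) / \<rho>"
  have M0: "M \<ge> 0" using r0 \<rho> by (simp add: M_def)
  have "norm (x n - xbar) \<le> M * \<tau> ^ n" for n
  proof -
    let ?q = "n div l"
    have "norm (x n - xbar) \<le> norm (x n - y ?q) + norm (y ?q - xbar)"
      using norm_triangle_ineq[of "x n - y ?q" "y ?q - xbar"] by simp
    also have "norm (x n - y ?q) \<le> 3 * r * \<rho> ^ ?q"
      using inner[of "n mod l" ?q] l by (simp add: less_imp_le)
    also have "norm (y ?q - xbar) \<le> 3 * r / (1 - \<rho>) * \<rho> ^ ?q" by (rule dist)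
    also have "3 * r * \<rho> ^ ?q + 3 * r / (1 - \<rho>) * \<rho> ^ ?q = M * \<rho> * \<rho> ^ ?q"
    proof -
      have "M * \<rho> = 3 * r + 3 * r / (1 - \<rho>)" using \<rho> by (simp add: M_def)
      then show ?thesis by (simp add: distrib_right)
    qed
    finally have "norm (x n - xbar) \<le> M * (\<rho> ^ ?q * \<rho>)" by (simp add: mult_ac)
    also have "\<rho> ^ ?q * \<rho> \<le> \<tau> ^ n"
    proof -
      have "\<rho> \<le> \<tau> ^ (n mod l)"
        using power_decreasing[of "n mod l" l \<tau>] \<tau> l by simp
      then have "\<rho> ^ ?q * \<rho> \<le> \<tau> ^ (l * ?q) * \<tau> ^ (n mod l)"
        using \<rho> by (simp add: power_mult \<tau>(1))
      then show ?thesis by (simp add: power_add[symmetric])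
    qed
    finally show ?thesis using M0 by (simp add: mult_left_mono)
  qed
  then have "R_linearly_converges_to x xbar"
    unfolding R_linearly_converges_to_def using \<tau> M0
    by (intro exI[of _ \<tau>] exI[of _ M]) auto
  with \<open>xbar \<in> S\<close> show ?thesis by blast
qed

theorem theorem5p21:
  fixes C :: "nat \<Rightarrow> 'a::euclidean_space set"
    and w :: 'a
    and m l :: nat
    and lam mu alpha :: "nat \<Rightarrow> real"
    and s t :: "nat \<Rightarrow> nat"
  assumes closed: "\<forall>i\<in>{1..m}. closed (C i)"
    and w: "w \<in> (\<Inter>i\<in>{1..m}. C i)"
    and l: "l > 0"
    and lam: "\<forall>j\<in>{1..l}. lam j \<in> {0<..2}"
    and mu: "\<forall>j\<in>{1..l}. mu j \<in> {0<..2}"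
    and alpha: "\<forall>j\<in>{1..l}. alpha j \<in> {0<..<1}"
    and st: "\<forall>j\<in>{1..l}. s j \<in> {1..m} \<and> t j \<in> {1..m} \<and> s j \<noteq> t j"
    and cover: "s ` {1..l} \<union> t ` {1..l} = {1..m}"
    and superregular: "superregular_system_at {1..m} C w"
    and linearly_regular: "linearly_regular_around {1..m} C w"
    and strongly_regular: "\<forall>j\<in>{1..l}. strongly_regular_at (C (s j)) (C (t j)) w"
  shows "\<exists>r>0. \<forall>x. x 0 \<in> cball w r \<longrightarrow>
           cyclic_sequence l
             (\<lambda>j. generalized_DR (alpha j) (lam j) (mu j) (C (s j)) (C (t j))) x \<longrightarrow>
           (\<exists>xbar \<in> (\<Inter>i\<in>{1..m}. C i). R_linearly_converges_to x xbar)"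
proof -

  \<comment> \<open>A step estimate with constants common to all operators\<close>
  define S where "S = (\<Inter>i\<in>{1..m}. C i)"
  define T where "T = (\<lambda>j. generalized_DR (alpha j) (lam j) (mu j) (C (s j)) (C (t j)))"
  have wS: "w \<in> S" and S: "closed S" using w closed by (auto simp: S_def)
  \<comment> \<open>Ensures that the maximum in the linear regularity inequality is attained by some
    index.\<close>
  have ne: "{1..m} \<noteq> {}" using st l by force
  \<comment> \<open>Comparison points are restricted to \<open>S\<close>, which lies in both sets of
    every operator. The property survives decreasing \<open>\<beta>\<close> or
    \<open>\<delta>\<close> and increasing \<open>K\<close>, so minima and maxima over the finitely
    many \<open>j\<close> give common constants.\<close>
  define good where "good j \<beta> K \<eta> \<delta> \<longleftrightarrow> (\<forall>x\<in>cball w \<delta>. \<forall>y\<in>T j x.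
       (\<forall>c\<in>S \<inter> cball w \<delta>.
          (norm (y - c))\<^sup>2 \<le> (1 + \<eta>) * (norm (x - c))\<^sup>2 - \<beta> * (norm (y - x))\<^sup>2) \<and>
       infdist x (C (s j)) \<le> K * norm (y - x) \<and> infdist x (C (t j)) \<le> K * norm (y - x))"
    for j \<beta> K \<eta> \<delta>
  have "\<exists>\<beta> K. \<beta> > 0 \<and> K > 0 \<and> (\<forall>\<eta>>0. \<exists>\<delta>>0. good j \<beta> K \<eta> \<delta>)" if j: "j \<in> {1..l}" for j
  proof -
    have *: "s j \<in> {1..m}" "t j \<in> {1..m}" using st j by auto
    have sub: "S \<subseteq> C (s j) \<inter> C (t j)" using * by (auto simp: S_def)
    have "w \<in> C (s j)" "w \<in> C (t j)" "lam j \<in> {0<..2}" "mu j \<in> {0<..2}" "alpha j \<in> {0<..<1}"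
      "superregular_at (C (s j)) w" "superregular_at (C (t j)) w"
      "strongly_regular_at (C (s j)) (C (t j)) w"
      using sub wS lam mu alpha superregular strongly_regular j *
      unfolding superregular_system_at_def by blast+
    note hyps = this
    obtain \<beta> K where \<beta>K: "\<beta> > 0" "K > 0" and
      step: "\<And>\<eta>. \<eta> > 0 \<Longrightarrow> \<exists>\<delta>>0. \<forall>x\<in>cball w \<delta>.
       \<forall>y\<in>generalized_DR (alpha j) (lam j) (mu j) (C (s j)) (C (t j)) x.
       (\<forall>c\<in>C (s j) \<inter> C (t j) \<inter> cball w \<delta>.
          (norm (y - c))\<^sup>2 \<le> (1 + \<eta>) * (norm (x - c))\<^sup>2 - \<beta> * (norm (y - x))\<^sup>2) \<and>
       infdist x (C (s j)) \<le> K * norm (y - x) \<and> infdist x (C (t j)) \<le> K * norm (y - x)"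
      using generalized_DR_step[OF hyps] by metis
    have "\<exists>\<delta>>0. good j \<beta> K \<eta> \<delta>" if "\<eta> > 0" for \<eta>
      using step[OF that] sub unfolding good_def T_def by blast
    with \<beta>K show ?thesis by blast
  qed
  then obtain \<beta>' K' where bK: "\<And>j. j \<in> {1..l} \<Longrightarrow> \<beta>' j > 0 \<and> K' j > 0 \<and> (\<forall>\<eta>>0. \<exists>\<delta>>0. good j (\<beta>' j) (K' j) \<eta> \<delta>)"
    by metis
  define \<beta> where "\<beta> = Min (\<beta>' ` {1..l})"
  define K where "K = Max (K' ` {1..l})"
  have nel: "{1..l} \<noteq> {}" using l by auto
  have \<beta>: "\<beta> > 0" "\<And>j. j \<in> {1..l} \<Longrightarrow> \<beta> \<le> \<beta>' j"
    using bK nel by (auto simp: \<beta>_def)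
  have K: "\<And>j. j \<in> {1..l} \<Longrightarrow> K' j \<le> K" by (auto simp: K_def)
  have K0: "K > 0" using K[of 1] bK[of 1] l by fastforce
  \<comment> \<open>\<open>\<eta>\<close> stays arbitrary here: it is fixed later through
    \<open>q\<close>, which depends on the common \<open>\<beta>\<close> and
    \<open>K\<close>.\<close>
  have good_uniform: "\<exists>\<delta>>0. \<forall>j\<in>{1..l}. good j \<beta> K \<eta> \<delta>" if "\<eta> > 0" for \<eta>
  proof -
    have "\<forall>j\<in>{1..l}. \<exists>\<delta>. \<delta> > 0 \<and> good j (\<beta>' j) (K' j) \<eta> \<delta>"
      using bK that by blast
    from bchoice[OF this] obtain \<delta>'
      where \<delta>': "\<And>j. j \<in> {1..l} \<Longrightarrow> \<delta>' j > 0 \<and> good j (\<beta>' j) (K' j) \<eta> (\<delta>' j)"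
      by blast
    define \<delta> where "\<delta> = Min (\<delta>' ` {1..l})"
    have "\<delta> > 0" using \<delta>' nel by (auto simp: \<delta>_def)
    moreover have "good j \<beta> K \<eta> \<delta>" if j: "j \<in> {1..l}" for j
    proof -
      have "\<delta> \<le> \<delta>' j" using j by (auto simp: \<delta>_def)
      then have sub: "cball w \<delta> \<subseteq> cball w (\<delta>' j)" by auto
      show ?thesis unfolding good_def
      proof (intro ballI conjI)
        fix x y assume x: "x \<in> cball w \<delta>" and y: "y \<in> T j x"
        have g: "(\<forall>c\<in>S \<inter> cball w (\<delta>' j).
          (norm (y - c))\<^sup>2 \<le> (1 + \<eta>) * (norm (x - c))\<^sup>2 - \<beta>' j * (norm (y - x))\<^sup>2) \<and>
          infdist x (C (s j)) \<le> K' j * norm (y - x) \<and> infdist x (C (t j)) \<le> K' j * norm (y - x)"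
          using \<delta>'[OF j] x y sub unfolding good_def by blast
        have "K' j * norm (y - x) \<le> K * norm (y - x)" using K[OF j] by (simp add: mult_right_mono)
        with g show "infdist x (C (s j)) \<le> K * norm (y - x)" "infdist x (C (t j)) \<le> K * norm (y - x)"
          by linarith+
        fix c assume "c \<in> S \<inter> cball w \<delta>"
        with g sub have "(norm (y - c))\<^sup>2 \<le> (1 + \<eta>) * (norm (x - c))\<^sup>2 - \<beta>' j * (norm (y - x))\<^sup>2"
          by blast
        moreover have "\<beta> * (norm (y - x))\<^sup>2 \<le> \<beta>' j * (norm (y - x))\<^sup>2"
          using \<beta>(2)[OF j] by (simp add: mult_right_mono)
        ultimately show "(norm (y - c))\<^sup>2 \<le> (1 + \<eta>) * (norm (x - c))\<^sup>2 - \<beta> * (norm (y - x))\<^sup>2"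
          by linarith
      qed
    qed
    ultimately show ?thesis by blast
  qed

  \<comment> \<open>Choice of the contraction factor and the radii\<close>
  obtain \<delta>1 \<kappa> where \<delta>1: "\<delta>1 > 0" and \<kappa>: "\<kappa> > 0"
    and lr: "\<And>x. x \<in> cball w \<delta>1 \<Longrightarrow> infdist x S \<le> \<kappa> * (MAX i\<in>{1..m}. infdist x (C i))"
    using linearly_regular unfolding linearly_regular_around_def S_def by blast
  \<comment> \<open>The constant in \<open>?D\<^sup>2 \<le> M * ?R\<close> below:
    \<open>\<kappa>\<close> stems from linear regularity, the rest from the path-length
    bound.\<close>
  define M where "M = \<kappa>\<^sup>2 * ((1 + K)\<^sup>2 * real l)"
  have M: "M > 0" using \<kappa> K0 l by (simp add: M_def)
  \<comment> \<open>Over a cycle the gain will be at least \<open>2 * q\<close> and the growth at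
    most \<open>q\<close> times the squared distance to \<open>S\<close>, which leaves the factor
    \<open>1 - q\<close>; hence the square root in \<open>\<rho>\<close>. The bound
    \<open>1/2\<close> keeps \<open>1 - q\<close> positive.\<close>
  define q where "q = min (1/2) (\<beta> / (2 * M))"
  have q: "0 < q" "q \<le> 1/2" "2 * q * M \<le> \<beta>" using M \<beta>(1) by (auto simp: q_def min_def field_simps)
  define \<rho> where "\<rho> = sqrt (1 - q)"
  have \<rho>: "0 < \<rho>" "\<rho> < 1" "\<rho>\<^sup>2 = 1 - q" using q by (auto simp: \<rho>_def)
  obtain \<eta> where \<eta>: "\<eta> > 0" "(1 + \<eta>) ^ l \<le> 1 + q"
  proof -
    have "((\<lambda>\<eta>::real. (1 + \<eta>) ^ l) \<longlongrightarrow> (1 + 0) ^ l) (at_right 0)" by (intro tendsto_intros)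
    then have "eventually (\<lambda>\<eta>. (1 + \<eta>) ^ l < 1 + q) (at_right (0::real))"
      using q by (intro order_tendstoD) auto
    then have "eventually (\<lambda>\<eta>. (1 + \<eta>) ^ l < 1 + q \<and> \<eta> > 0) (at_right (0::real))"
      using eventually_at_right_less eventually_conj by blast
    then show ?thesis using that eventually_happens[of _ "at_right (0::real)"]
      by (force simp: less_imp_le)
  qed
  obtain \<delta>2 where \<delta>2: "\<delta>2 > 0" and good: "\<And>j. j \<in> {1..l} \<Longrightarrow> good j \<beta> K \<eta> \<delta>2"
    using good_uniform[OF \<eta>(1)] by blast
  \<comment> \<open>Cycle starts must lie where linear regularity holds, and within a quarter of
    \<open>\<delta>2\<close> so that the whole cycle stays where the step estimate holds.\<close>
  define \<delta> where "\<delta> = min \<delta>1 (\<delta>2 / 4)"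
  have \<delta>: "\<delta> > 0" "\<delta> \<le> \<delta>1" "\<delta> \<le> \<delta>2 / 4" using \<delta>1 \<delta>2 by (auto simp: \<delta>_def)
  \<comment> \<open>The solution of \<open>r + 3 * r / (1 - \<rho>) = \<delta>\<close>.\<close>
  define r where "r = \<delta> / (1 + 3 / (1 - \<rho>))"
  have pos: "1 + 3 / (1 - \<rho>) > 0" using \<rho> by (simp add: add_pos_pos)
  have r: "r > 0" using \<delta> pos by (simp add: r_def)
  have "r * (1 + 3 / (1 - \<rho>)) = \<delta>" using pos by (simp add: r_def)
  then have r2: "r + 3 * r / (1 - \<rho>) \<le> \<delta>" by (simp add: algebra_simps)

  \<comment> \<open>Contraction over one cycle\<close>
  show ?thesis
    unfolding S_def[symmetric] T_def[symmetric]
  proof (intro exI[of _ r] conjI[OF r] allI impI)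
    fix x assume x0: "x 0 \<in> cball w r" and cyc: "cyclic_sequence l T x"
    show "\<exists>xbar\<in>S. R_linearly_converges_to x xbar"
    proof (rule R_linear_convergence_of_cycles[OF S wS l \<rho>(1,2) _ r2])
      show "norm (x 0 - w) \<le> r" using x0 by (simp add: dist_norm norm_minus_commute)
      fix n assume near: "norm (x (l * n) - w) \<le> \<delta>"
      define z where "z k = x (l * n + k)" for k
      \<comment> \<open>Steps in a cycle are counted from 0 but operators from 1, so step
        \<open>k\<close> applies \<open>T (Suc k)\<close>.\<close>
      have zT: "z (Suc k) \<in> T (Suc k) (z k)" if "k < l" for k
      proof -
        have "cyclic_extension l T (l * n + Suc k) = T (Suc k)"
          using that by (intro cyclic_extension_periodic) auto
        then show ?thesis using cyc unfolding cyclic_sequence_def z_def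
          by (metis Suc_eq_plus1 add_Suc_right)
      qed
      obtain c where c: "c \<in> projector S (z 0)" using projector_nonempty[OF S] wS by blast
      have cS: "c \<in> S" using c by (simp add: projector_def)
      let ?D = "infdist (z 0) S"
      let ?R = "\<Sum>i<l. (norm (z (Suc i) - z i))\<^sup>2"
      have z0: "norm (z 0 - w) \<le> \<delta>2 / 4" using near \<delta> by (simp add: z_def)
      have \<eta>l: "(1 + \<eta>) ^ l \<le> 4" using \<eta> q by linarith
      have step: "(norm (z (Suc k) - c))\<^sup>2
          \<le> (1 + \<eta>) * (norm (z k - c))\<^sup>2 - \<beta> * (norm (z (Suc k) - z k))\<^sup>2"
        if "k < l" "z k \<in> cball w \<delta>2" "c \<in> cball w \<delta>2" for k
        using good[of "Suc k"] zT[OF that(1)] that cS unfolding good_def by auto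
      note Fejer = quasi_Fejer_cycle[where z = z, OF c wS z0 less_imp_le[OF \<eta>(1)] \<eta>l less_imp_le[OF \<beta>(1)] step]
      have "?D\<^sup>2 \<le> M * ?R"
      proof -
        have "z 0 \<in> cball w \<delta>1" using near \<delta> by (simp add: z_def dist_norm norm_minus_commute)
        from lr[OF this] have D: "?D \<le> \<kappa> * (MAX i\<in>{1..m}. infdist (z 0) (C i))" .
        \<comment> \<open>\<open>C i\<close> is a farthest set from \<open>z 0\<close>. By
          \<open>cover\<close> it belongs to some operator \<open>j\<close>, which acts at step
          \<open>k = j - 1\<close>; the length of that step bounds the distance from
          \<open>z k\<close> to \<open>C i\<close>.\<close>
        obtain i where i: "i \<in> {1..m}" "(MAX i\<in>{1..m}. infdist (z 0) (C i)) = infdist (z 0) (C i)"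
          using Max_in[of "(\<lambda>i. infdist (z 0) (C i)) ` {1..m}"] ne
          by (metis (no_types, lifting) finite_atLeastAtMost finite_imageI imageE image_is_empty)
        obtain j where j: "j \<in> {1..l}" "i = s j \<or> i = t j" using i(1) cover by blast
        then obtain k where k: "j = Suc k" "k < l" by (cases j) auto
        have "infdist (z k) (C i) \<le> K * norm (z (Suc k) - z k)"
          using good[OF j(1)] zT[OF k(2)] Fejer(1)[of k] k j(2) unfolding good_def by auto
        from infdist_le_path_length[of k l z, OF k(2) this] K0
        have "(infdist (z 0) (C i))\<^sup>2 \<le> (1 + K)\<^sup>2 * real l * ?R" by simp
        then have "\<kappa>\<^sup>2 * (infdist (z 0) (C i))\<^sup>2 \<le> \<kappa>\<^sup>2 * ((1 + K)\<^sup>2 * real l * ?R)"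
          by (intro mult_left_mono) auto
        moreover have "?D\<^sup>2 \<le> (\<kappa> * infdist (z 0) (C i))\<^sup>2"
          using D i(2) by (intro power_mono infdist_nonneg) simp
        ultimately show ?thesis by (simp add: M_def power_mult_distrib mult.assoc)
      qed
      then have "2 * q * ?D\<^sup>2 \<le> 2 * q * (M * ?R)" using q by (intro mult_left_mono) auto
      also have "\<dots> = (2 * q * M) * ?R" by simp
      also have "\<dots> \<le> \<beta> * ?R" using q by (intro mult_right_mono) (auto simp: sum_nonneg)
      finally have gain: "2 * q * ?D\<^sup>2 \<le> \<beta> * ?R" .
      have "(norm (z l - c))\<^sup>2 \<le> (1 + \<eta>) ^ l * ?D\<^sup>2 - \<beta> * ?R" using Fejer(3)[of l] by simp
      also have "\<dots> \<le> (1 + q) * ?D\<^sup>2 - 2 * q * ?D\<^sup>2"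
        using \<eta>(2) gain by (intro diff_mono mult_right_mono) auto
      also have "\<dots> = (\<rho> * ?D)\<^sup>2" by (simp add: power_mult_distrib \<rho>(3) algebra_simps)
      finally have "norm (z l - c) \<le> \<rho> * ?D"
        using \<rho>(1) infdist_nonneg by (meson power2_le_imp_le mult_nonneg_nonneg less_imp_le)
      moreover have "infdist (z l) S \<le> norm (z l - c)"
        using infdist_le[OF cS, of "z l"] by (simp add: dist_norm)
      ultimately have "infdist (z l) S \<le> \<rho> * ?D" by simp
      with Fejer(2) show "(\<forall>k\<le>l. norm (x (l * n + k) - x (l * n)) \<le> 3 * infdist (x (l * n)) S) \<and>
          infdist (x (l * n + l)) S \<le> \<rho> * infdist (x (l * n)) S"
        by (simp add: z_def)
    qed
  qed
qed

end
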